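(* Suppose that $\mathcal{F}(\cdot)$ is locally open at $\bar w$. If $\bar w$ is a local minimum of the problem (P) $\min_{w\in\mathcal{W}}\ell(\mathcal{F}(w))$, then $\bar z=\mathcal{F}(\bar w)$ is a local minimum of the auxiliary problem (Q) $\min_{z\in\mathcal{Z}}\ell(z)$. Furthermore, if all local minima of the auxiliary problem (Q) are global, then every local minimum of (P) is globally optimal.
   Context: $\mathcal{W}$ and $\mathcal{Z}$ are subsets of finite-dimensional Euclidean spaces, $\mathcal{F}:\mathcal{W}\to\mathcal{Z}$ is a mapping, $\mathcal{Z}$ is the range of $\mathcal{F}$, and $\ell:\mathcal{Z}\to\mathbb{R}$ is a (loss) function. The mapping $\mathcal{F}$ is said to be locally open at $w$ if for every $\epsilon>0$ there exists $\delta>0$ such that $B_\delta(\mathcal{F}(w))\cap\mathcal{R}_{\mathcal{F}}\subseteq\mathcal{F}(B_\epsilon(w))$, where $B_\epsilon(w)\subseteq\mathcal{W}$ is the open ball of radius $\epsilon$ centered at $w$, $B_\delta(\mathcal{F}(w))$ is the ball of radius $\delta$ centered at $\mathcal{F}(w)$, and $\mathcal{R}_{\mathcal{F}}$ is the range of $\mathcal{F}$. Local minima of (P) and (Q) are relative to $\mathcal{W}$ and $\mathcal{Z}$, respectively.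
   Formalization: In the "Furthermore" part, local openness of the mapping is assumed at each local minimum of (P) that is claimed to be globally optimal; openness at one fixed point alone does not suffice (F(w)=w³−3w on [−3,2], identity loss, openness at 0, local minimum at 1). *)

theory Defs
  imports "HOL-Analysis.Analysis"
begin

definition is_global_min :: "('a \<Rightarrow> real) \<Rightarrow> 'a set \<Rightarrow> 'a \<Rightarrow> bool" where
  "is_global_min f S x \<longleftrightarrow> is_arg_min f (\<lambda>y. y \<in> S) x"

text \<open>Balls in \<open>S\<close> are the traces on \<open>S\<close> of the open balls of the ambient space, so that
  minimality is relative to \<open>S\<close>.\<close>

definition is_local_min :: "('a::metric_space \<Rightarrow> real) \<Rightarrow> 'a set \<Rightarrow> 'a \<Rightarrow> bool" where
  "is_local_min f S x \<longleftrightarrow> x \<in> S \<and> (\<exists>e>0. is_global_min f (S \<inter> ball x e) x)"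

definition locally_open_at ::
    "('a::metric_space \<Rightarrow> 'b::metric_space) \<Rightarrow> 'a set \<Rightarrow> 'a \<Rightarrow> bool" where
  "locally_open_at F W w \<longleftrightarrow>
     (\<forall>\<epsilon>>0. \<exists>\<delta>>0. ball (F w) \<delta> \<inter> F ` W \<subseteq> F ` (W \<inter> ball w \<epsilon>))"

end

theory Submission
  imports Defs
begin

text \<open>
  Local openness lets every point of the range near \<open>F w\<close> be lifted to a preimage near \<open>w\<close>.
  A range point near \<open>F w\<close> with smaller loss would thus have a preimage with smaller objective
  inside the neighbourhood on which \<open>w\<close> is minimal; hence local minimality passes from \<open>w\<close> to
  \<open>F w\<close> (\<open>local_min_image\<close>). Going back is possible for global minima and uses nothing about
  \<open>F\<close>: the objective takes on \<open>W\<close> exactly the values of \<open>l\<close> on \<open>F ` W\<close>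
  (\<open>global_min_image_iff\<close>). So if all local minima of \<open>l\<close> on the range are global, the local
  minimum \<open>F w\<close> is global there, and then so is \<open>w\<close> on \<open>W\<close>.
\<close>

lemma global_min_iff: "is_global_min f S x \<longleftrightarrow> x \<in> S \<and> (\<forall>y\<in>S. f x \<le> f y)"
  by (auto simp: is_global_min_def is_arg_min_def not_less)

lemma global_min_image_iff:
  assumes "w \<in> W"
  shows "is_global_min l (F ` W) (F w) \<longleftrightarrow> is_global_min (\<lambda>v. l (F v)) W w"
  using assms by (auto simp: global_min_iff)

lemma local_min_image:
  assumes op: "locally_open_at F W w" and min: "is_local_min (\<lambda>v. l (F v)) W w"
  shows "is_local_min l (F ` W) (F w)"
proof -
  from min obtain \<epsilon> where "w \<in> W" "\<epsilon> > 0"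
    and min_ball: "is_global_min (\<lambda>v. l (F v)) (W \<inter> ball w \<epsilon>) w"
    by (auto simp: is_local_min_def)
  from op \<open>\<epsilon> > 0\<close> obtain \<delta> where "\<delta> > 0"
    and lift: "ball (F w) \<delta> \<inter> F ` W \<subseteq> F ` (W \<inter> ball w \<epsilon>)"
    unfolding locally_open_at_def by meson
  have "l (F w) \<le> l z" if z: "z \<in> F ` W \<inter> ball (F w) \<delta>" for z
  proof -
    have "z \<in> F ` (W \<inter> ball w \<epsilon>)"
      by (rule subsetD[OF lift]) (use z in simp)
    then obtain v where "v \<in> W \<inter> ball w \<epsilon>" "z = F v"
      by (rule imageE)
    with min_ball show ?thesis
      by (simp add: global_min_iff)
  qed
  then have "is_global_min l (F ` W \<inter> ball (F w) \<delta>) (F w)"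
    using \<open>w \<in> W\<close> \<open>\<delta> > 0\<close> by (simp add: global_min_iff)
  then show ?thesis
    using \<open>w \<in> W\<close> \<open>\<delta> > 0\<close> by (auto simp: is_local_min_def)
qed

theorem mainTheorem1:
  fixes F :: "'a::euclidean_space \<Rightarrow> 'b::euclidean_space"
    and W :: "'a set" and Z :: "'b set"
    and l :: "'b \<Rightarrow> real"
  assumes "Z = F ` W"
  shows "(\<forall>w\<in>W. locally_open_at F W w \<longrightarrow>
            is_local_min (\<lambda>v. l (F v)) W w \<longrightarrow> is_local_min l Z (F w)) \<and>
         ((\<forall>z. is_local_min l Z z \<longrightarrow> is_global_min l Z z) \<longrightarrow>
           (\<forall>w\<in>W. locally_open_at F W w \<longrightarrow>
              is_local_min (\<lambda>v. l (F v)) W w \<longrightarrow> is_global_min (\<lambda>v. l (F v)) W w))"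
  unfolding assms
proof (intro conjI impI ballI)
  fix w assume "locally_open_at F W w" "is_local_min (\<lambda>v. l (F v)) W w"
  then show "is_local_min l (F ` W) (F w)"
    by (rule local_min_image)
next
  fix w assume "\<forall>z. is_local_min l (F ` W) z \<longrightarrow> is_global_min l (F ` W) z" "w \<in> W"
    and "locally_open_at F W w" "is_local_min (\<lambda>v. l (F v)) W w"
  then have "is_global_min l (F ` W) (F w)"
    using local_min_image[of F W w l] by simp
  with \<open>w \<in> W\<close> show "is_global_min (\<lambda>v. l (F v)) W w"
    using global_min_image_iff[of w W l F] by simp
qed

end
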